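(* Let $U\subset\mathbb{R}^N$ be a (bounded) set that is Minkowski measurable in $\mathbb{R}^N$, with box dimension $d\in[0,N]$. Then $U$, regarded as a subset of $\mathbb{R}^{N+1}$ (i.e. $U\times\{0\}\subset\mathbb{R}^{N+1}$), is also Minkowski measurable in $\mathbb{R}^{N+1}$. Moreover, $$\frac{\mathcal{M}(U,\mathbb{R}^{N+1})}{\gamma_{N+1-d}}=\frac{\mathcal{M}(U,\mathbb{R}^N)}{\gamma_{N-d}}.$$ In other words, the normalized Minkowski content of a Minkowski measurable set is unchanged by the embedding $\mathbb{R}^N\hookrightarrow\mathbb{R}^{N+1}$: $\overline{\mathcal{M}}(U,\mathbb{R}^{N+1})=\overline{\mathcal{M}}(U,\mathbb{R}^N)$.
   Context: For a bounded set $U\subset\mathbb{R}^N$ and $\varepsilon>0$, let $U_\varepsilon^N=\{x\in\mathbb{R}^N: d_N(x,U)\le\varepsilon\}$, where $d_N$ is the Euclidean distance, and let $\mathrm{vol}_N$ be Lebesgue measure on $\mathbb{R}^N$. The lower and upper $s$-dimensional Minkowski contents of $U$ in $\mathbb{R}^N$ are $$\mathcal{M}^s_*(U,\mathbb{R}^N)=\liminf_{\varepsilon\to0}\frac{\mathrm{vol}_N(U_\varepsilon^N)}{\varepsilon^{N-s}},\qquad \mathcal{M}^{*s}(U,\mathbb{R}^N)=\limsup_{\varepsilon\to0}\frac{\mathrm{vol}_N(U_\varepsilon^N)}{\varepsilon^{N-s}},$$ with values in $[0,\infty]$. The lower box dimension is $\underline{\dim}_B(U,\mathbb{R}^N)=\sup\{s\ge0:\mathcal{M}_*^s(U,\mathbb{R}^N)=\infty\}=\inf\{s\ge0:\mathcal{M}_*^s(U,\mathbb{R}^N)=0\}$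 and the upper box dimension is $\overline{\dim}_B(U,\mathbb{R}^N)=\sup\{s\ge0:\mathcal{M}^{*s}(U,\mathbb{R}^N)=\infty\}=\inf\{s\ge0:\mathcal{M}^{*s}(U,\mathbb{R}^N)=0\}$ (the content formulas being used for all $s\ge0$, and $\sup\emptyset=0$). If they agree, the common value is the box dimension $\dim_B(U,\mathbb{R}^N)$. A bounded set $U\subset\mathbb{R}^N$ with box dimension $d=\dim_B(U,\mathbb{R}^N)$ is Minkowski measurable in $\mathbb{R}^N$ if $\mathcal{M}^d_*(U,\mathbb{R}^N)=\mathcal{M}^{*d}(U,\mathbb{R}^N)\in(0,\infty)$; the common value is denoted $\mathcal{M}(U,\mathbb{R}^N)$. The same definitions, with $N+1$ in place of $N$, are applied to $U$ viewed in $\mathbb{R}^{N+1}$, i.e. to $U\times\{0\}$; these are denoted with $\mathbb{R}^{N+1}$ in place of $\mathbb{R}^N$. For real $t\ge0$, $\gamma_t=\dfrac{\pi^{t/2}}{\Gamma(t/2+1)}$, where $\Gamma$ is the gamma function. The normalized Minkowski content of a Minkowski measurable set of box dimension $d$ in $\mathbb{R}^N$ is $\overline{\mathcal{M}}(U,\mathbb{R}^N)=\mathcal{M}(U,\mathbb{R}^N)/\gamma_{N-d}$, and in $\mathbb{R}^{N+1}$ it is $\mathcal{M}(U,\mathbb{R}^{N+1})/\gamma_{N+1-d}$. *)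

theory Defs
  imports "HOL-Analysis.Analysis"
begin

text \<open>The case distinction implements the convention that points have infinite distance to the
  empty set, whereas \<open>infdist x {} = 0\<close>.\<close>

definition closed_nbhd :: "'a::euclidean_space set \<Rightarrow> real \<Rightarrow> 'a set" where
  "closed_nbhd U \<epsilon> = (if U = {} then {} else {x. infdist x U \<le> \<epsilon>})"

definition minkowski_ratio :: "real \<Rightarrow> 'a::euclidean_space set \<Rightarrow> real \<Rightarrow> ennreal" where
  "minkowski_ratio s U \<epsilon> =
     emeasure lebesgue (closed_nbhd U \<epsilon>) / ennreal (\<epsilon> powr (real DIM('a) - s))"

definition lower_minkowski_content :: "real \<Rightarrow> 'a::euclidean_space set \<Rightarrow> ennreal" where
  "lower_minkowski_content s U = Liminf (at_right 0) (minkowski_ratio s U)"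

definition upper_minkowski_content :: "real \<Rightarrow> 'a::euclidean_space set \<Rightarrow> ennreal" where
  "upper_minkowski_content s U = Limsup (at_right 0) (minkowski_ratio s U)"

text \<open>Inserting \<open>0\<close> implements \<open>Sup {} = 0\<close>. The sets below are bounded above by the dimension of
  the ambient space as soon as \<open>U\<close> is bounded; the dimensions are only used for bounded \<open>U\<close>.\<close>

definition lower_box_dim :: "'a::euclidean_space set \<Rightarrow> real" where
  "lower_box_dim U = Sup (insert 0 {s. 0 \<le> s \<and> lower_minkowski_content s U = \<infinity>})"

definition upper_box_dim :: "'a::euclidean_space set \<Rightarrow> real" where
  "upper_box_dim U = Sup (insert 0 {s. 0 \<le> s \<and> upper_minkowski_content s U = \<infinity>})"

definition has_box_dim :: "'a::euclidean_space set \<Rightarrow> real \<Rightarrow> bool" where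
  "has_box_dim U d \<longleftrightarrow> lower_box_dim U = d \<and> upper_box_dim U = d"

definition box_dim :: "'a::euclidean_space set \<Rightarrow> real" where
  "box_dim U = (THE d. has_box_dim U d)"

definition minkowski_measurable :: "'a::euclidean_space set \<Rightarrow> bool" where
  "minkowski_measurable U \<longleftrightarrow> bounded U \<and>
     (\<exists>d. has_box_dim U d \<and>
          lower_minkowski_content d U = upper_minkowski_content d U \<and>
          0 < lower_minkowski_content d U \<and> lower_minkowski_content d U < \<infinity>)"

text \<open>Only meaningful for Minkowski measurable sets, where the lower and upper contents agree.\<close>

definition minkowski_content :: "'a::euclidean_space set \<Rightarrow> ennreal" where
  "minkowski_content U = lower_minkowski_content (box_dim U) U"

text \<open>The normalizing constant \<open>pi powr (t / 2) / Gamma (t / 2 + 1)\<close>, for real \<open>t\<close>, is the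
  library's \<^const>\<open>unit_ball_vol\<close>.\<close>

definition normalized_minkowski_content :: "'a::euclidean_space set \<Rightarrow> ennreal" where
  "normalized_minkowski_content U =
     minkowski_content U / ennreal (unit_ball_vol (real DIM('a) - box_dim U))"

end

theory Submission
  imports Defs "HOL-Real_Asymp.Real_Asymp"
begin

text \<open>
  Put \<open>N = DIM('a)\<close>. The slice of the closed \<open>\<epsilon>\<close>-neighbourhood of \<open>U \<times> {0}\<close> at height \<open>t\<close> is, by
  Pythagoras, the closed neighbourhood of \<open>U\<close> of radius \<open>sqrt (\<epsilon>\<^sup>2 - t\<^sup>2)\<close>. Cavalieri's principle
  therefore expresses the volume of the former as the integral over \<open>t \<in> {-\<epsilon>..\<epsilon>}\<close> of the volumes
  of the latter (\<open>emeasure_closed_nbhd_embed\<close>).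

  If the volume of the \<open>r\<close>-neighbourhood of \<open>U\<close> behaves like \<open>M r\<^sup>a\<close> with \<open>a = N - d \<ge> 0\<close>, the
  integral behaves like \<open>M\<close> times the integral of \<open>sqrt (\<epsilon>\<^sup>2 - t\<^sup>2)\<^sup>a\<close>. The latter is a Beta
  integral; its value is \<open>\<epsilon>\<^sup>a\<^sup>+\<^sup>1\<close> times the quotient of the normalizing constants for \<open>a + 1\<close> and
  \<open>a\<close> (\<open>nn_integral_half_disc_powr\<close>). This quotient is exactly what the normalization divides
  out, so the content of \<open>U \<times> {0}\<close> at the exponent \<open>d\<close> exists and its normalization is that of
  \<open>U\<close> (\<open>tendsto_minkowski_ratio_embed\<close>).

  The dimension of \<open>U \<times> {0}\<close> is recovered from this limit: a positive finite limit of the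
  Minkowski ratios at an exponent \<open>d \<ge> 0\<close> forces the limits \<open>\<infinity>\<close> below \<open>d\<close> and \<open>0\<close> above \<open>d\<close>,
  hence box dimension \<open>d\<close> (\<open>has_box_dim_if_tendsto\<close>).
\<close>

section \<open>A Beta integral\<close>

text \<open>Legendre's duplication formula for the Gamma function in the form in which the symmetric
  Beta integral produces it.\<close>

lemma Beta_symmetric_unit_ball_vol:
  fixes a :: real
  assumes "0 \<le> a"
  shows "2 powr (a + 1) * Beta (a / 2 + 1) (a / 2 + 1) = unit_ball_vol (a + 1) / unit_ball_vol a"
proof -
  define z where "z = a / 2 + 1"
  have z: "z > 0" "a = 2 * z - 2" using assms by (auto simp: z_def)
  have nonpole: "complex_of_real x \<notin> \<int>\<^sub>\<le>\<^sub>0" if "x > 0" for x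
    using that by (metis Re_complex_of_real complex_nonpos_Reals_iff nonpos_Ints_subset_nonpos_Reals
        not_less subsetD)
  have "complex_of_real (Gamma z * Gamma (z + 1/2))
        = complex_of_real (exp ((1 - 2*z) * ln 2) * sqrt pi * Gamma (2*z))"
    using Gamma_legendre_duplication[of "complex_of_real z"] nonpole[of z] nonpole[of "z + 1/2"] z
    by (simp flip: Gamma_complex_of_real exp_of_real)
  hence dup: "Gamma z * Gamma (z + 1/2) = exp ((1 - 2*z) * ln 2) * sqrt pi * Gamma (2*z)"
    unfolding of_real_eq_iff .
  have p: "2 powr (2*z - 1) * exp ((1 - 2*z) * ln 2) = (1::real)"
    by (simp add: powr_def flip: exp_add) (simp add: algebra_simps)
  have pos: "Gamma z > 0" "Gamma (z + 1/2) > 0" "Gamma (2*z) > 0" using z by auto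
  have "2 powr (2*z - 1) * (Gamma z * Gamma (z + 1/2)) = sqrt pi * Gamma (2*z)"
    unfolding dup using p by (metis mult.assoc mult_1)
  hence "2 powr (2*z - 1) * (Gamma z * Gamma z / Gamma (2*z)) = sqrt pi * Gamma z / Gamma (z + 1/2)"
    using pos by (simp add: field_simps)
  moreover have "pi powr ((a + 1) / 2) / pi powr (a / 2) = sqrt pi"
    by (simp flip: powr_diff powr_half_sqrt) (simp add: field_simps)
  hence "unit_ball_vol (a + 1) / unit_ball_vol a = sqrt pi * Gamma z / Gamma (z + 1/2)"
    by (auto simp: unit_ball_vol_def z_def field_simps)
  ultimately show ?thesis
    by (simp add: Beta_def z_def algebra_simps add_divide_distrib)
qed

text \<open>The factor by which one extra dimension changes the normalizing constant. The affine
  substitution \<open>t = r (2 x - 1)\<close> turns \<open>r\<^sup>2 - t\<^sup>2\<close> into \<open>4 r\<^sup>2 x (1 - x)\<close>, so the integral is a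
  symmetric Beta integral.\<close>

lemma nn_integral_half_disc_powr:
  fixes a r :: real
  assumes a: "0 \<le> a" and r: "0 < r"
  shows "(\<integral>\<^sup>+t. indicator {-r..r} t * ennreal (sqrt (r\<^sup>2 - t\<^sup>2) powr a) \<partial>lborel) =
    ennreal (r powr (a + 1) * (unit_ball_vol (a + 1) / unit_ball_vol a))"
proof -
  let ?b = "a / 2 + 1"
  let ?f = "\<lambda>x::real. x powr (a/2) * (1 - x) powr (a/2)"
  have I: "(?f has_integral Beta ?b ?b) {0..1}"
    using has_integral_Beta_real[of ?b ?b] a by simp
  have eq: "indicator {-r..r} (2 * r * x - r) * ennreal (sqrt (r\<^sup>2 - (2 * r * x - r)\<^sup>2) powr a)
      = ennreal ((2 * r) powr a) * (ennreal (?f x) * indicator {0..1} x)" for x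
  proof (cases "x \<in> {0..1}")
    case True
    have "r\<^sup>2 - (2 * r * x - r)\<^sup>2 = (2 * r)\<^sup>2 * (x * (1 - x))"
      by (simp add: power2_eq_square algebra_simps)
    hence "sqrt (r\<^sup>2 - (2 * r * x - r)\<^sup>2) = 2 * r * (sqrt x * sqrt (1 - x))"
      using r by (simp add: real_sqrt_mult)
    hence "sqrt (r\<^sup>2 - (2 * r * x - r)\<^sup>2) powr a = (2 * r) powr a * ?f x"
      using r True by (simp add: powr_mult powr_powr flip: powr_half_sqrt)
    moreover have "2 * r * x - r \<in> {-r..r}" using True r by (auto simp: mult_le_cancel_left_pos)
    ultimately show ?thesis using True by (simp add: ennreal_mult)
  next
    case False
    hence "2 * r * x - r \<notin> {-r..r}" using r by (auto simp: zero_le_mult_iff)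
    thus ?thesis using False by simp
  qed
  have "(\<integral>\<^sup>+t. indicator {-r..r} t * ennreal (sqrt (r\<^sup>2 - t\<^sup>2) powr a) \<partial>lborel) =
     ennreal (2 * r) * (\<integral>\<^sup>+x. ennreal ((2 * r) powr a) * (ennreal (?f x) * indicator {0..1} x) \<partial>lborel)"
    using r by (subst nn_integral_real_affine[where c = "2 * r" and t = "-r"]) (auto simp: eq)
  also have "\<dots> = ennreal (2 * r) * (ennreal ((2 * r) powr a) * ennreal (Beta ?b ?b))"
    by (subst nn_integral_cmult) (auto simp: nn_integral_has_integral_lebesgue'[OF _ I])
  also have "\<dots> = ennreal (r powr (a + 1) * (2 powr (a + 1) * Beta ?b ?b))"
    using r by (simp add: powr_mult powr_add mult_ac flip: ennreal_mult')
  finally show ?thesis using Beta_symmetric_unit_ball_vol[OF a] by simp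
qed

section \<open>Neighbourhoods of an embedded set\<close>

lemma infdist_embed:
  fixes U :: "'a::euclidean_space set"
  assumes "U \<noteq> {}"
  shows "infdist (x, t) (U \<times> {0::real}) = sqrt ((infdist x U)\<^sup>2 + t\<^sup>2)"
proof (rule antisym)
  \<comment> \<open>The distance need not be attained in \<open>U\<close>, but it is attained in the closure.\<close>
  obtain u where u: "u \<in> closure U" "infdist x (closure U) = dist x u"
    using infdist_attains_inf[of "closure U" x] assms by auto
  have "infdist (x, t) (closure (U \<times> {0::real})) \<le> dist (x, t) (u, 0)"
    using u(1) by (intro infdist_le) (simp add: closure_Times)
  thus "infdist (x, t) (U \<times> {0::real}) \<le> sqrt ((infdist x U)\<^sup>2 + t\<^sup>2)"
    using u(2) by (simp add: infdist_eq_setdist dist_Pair_Pair)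
  have "sqrt ((infdist x U)\<^sup>2 + t\<^sup>2) \<le> dist (x, t) p" if "p \<in> U \<times> {0::real}" for p
    using that by (auto simp: dist_Pair_Pair intro!: power_mono infdist_le infdist_nonneg)
  thus "sqrt ((infdist x U)\<^sup>2 + t\<^sup>2) \<le> infdist (x, t) (U \<times> {0::real})"
    using assms by (auto simp: infdist_notempty intro!: cINF_greatest)
qed

lemma closed_closed_nbhd: "closed (closed_nbhd U \<epsilon>)"
  by (auto simp: closed_nbhd_def intro!: closed_Collect_le continuous_intros)

lemma emeasure_lebesgue_closed_nbhd:
  "emeasure lebesgue (closed_nbhd U \<epsilon>) = emeasure lborel (closed_nbhd U \<epsilon>)"
  using borel_closed[OF closed_closed_nbhd, of U \<epsilon>] by simp

lemma closed_nbhd_embed_slice: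
  fixes U :: "'a::euclidean_space set"
  assumes "0 \<le> \<epsilon>"
  shows "(\<lambda>x. (x, t)) -` closed_nbhd (U \<times> {0::real}) \<epsilon> =
    (if t \<in> {-\<epsilon>..\<epsilon>} then closed_nbhd U (sqrt (\<epsilon>\<^sup>2 - t\<^sup>2)) else {})"
proof (cases "U = {}")
  case False
  have "sqrt ((infdist x U)\<^sup>2 + t\<^sup>2) \<le> \<epsilon> \<longleftrightarrow> t \<in> {-\<epsilon>..\<epsilon>} \<and> infdist x U \<le> sqrt (\<epsilon>\<^sup>2 - t\<^sup>2)" for x
  proof -
    have "sqrt ((infdist x U)\<^sup>2 + t\<^sup>2) \<le> \<epsilon> \<longleftrightarrow> (infdist x U)\<^sup>2 + t\<^sup>2 \<le> \<epsilon>\<^sup>2"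
      using assms by (intro real_sqrt_le_iff') auto
    also have "\<dots> \<longleftrightarrow> t\<^sup>2 \<le> \<epsilon>\<^sup>2 \<and> (infdist x U)\<^sup>2 \<le> \<epsilon>\<^sup>2 - t\<^sup>2"
      using zero_le_power2[of "infdist x U"] by linarith
    also have "t\<^sup>2 \<le> \<epsilon>\<^sup>2 \<longleftrightarrow> t \<in> {-\<epsilon>..\<epsilon>}"
      using assms by (auto simp: abs_le_square_iff[symmetric])
    also have "(infdist x U)\<^sup>2 \<le> \<epsilon>\<^sup>2 - t\<^sup>2 \<longleftrightarrow> infdist x U \<le> sqrt (\<epsilon>\<^sup>2 - t\<^sup>2)"
      by (metis infdist_nonneg real_le_rsqrt real_sqrt_le_iff real_sqrt_unique)
    finally show ?thesis .
  qed
  thus ?thesis using False by (auto simp: closed_nbhd_def infdist_embed)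
qed (simp add: closed_nbhd_def)

lemma emeasure_closed_nbhd_embed:
  fixes U :: "'a::euclidean_space set"
  assumes "0 \<le> \<epsilon>"
  shows "emeasure lebesgue (closed_nbhd (U \<times> {0::real}) \<epsilon>) =
    (\<integral>\<^sup>+t. indicator {-\<epsilon>..\<epsilon>} t * emeasure lebesgue (closed_nbhd U (sqrt (\<epsilon>\<^sup>2 - t\<^sup>2))) \<partial>lborel)"
proof -
  have meas: "closed_nbhd (U \<times> {0::real}) \<epsilon> \<in> sets (lborel \<Otimes>\<^sub>M lborel)"
    unfolding lborel_prod using borel_closed[OF closed_closed_nbhd] by simp
  have "emeasure lebesgue (closed_nbhd (U \<times> {0::real}) \<epsilon>) =
      emeasure (lborel \<Otimes>\<^sub>M lborel) (closed_nbhd (U \<times> {0::real}) \<epsilon>)"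
    unfolding lborel_prod by (rule emeasure_lebesgue_closed_nbhd)
  also have "\<dots> = (\<integral>\<^sup>+t. emeasure lborel ((\<lambda>x. (x, t)) -` closed_nbhd (U \<times> {0::real}) \<epsilon>) \<partial>lborel)"
    by (rule lborel_pair.emeasure_pair_measure_alt2[OF meas])
  also have "\<dots> = (\<integral>\<^sup>+t. indicator {-\<epsilon>..\<epsilon>} t *
      emeasure lebesgue (closed_nbhd U (sqrt (\<epsilon>\<^sup>2 - t\<^sup>2))) \<partial>lborel)"
    by (intro nn_integral_cong)
      (simp add: closed_nbhd_embed_slice[OF assms] emeasure_lebesgue_closed_nbhd)
  finally show ?thesis .
qed

section \<open>Minkowski ratios of an embedded set\<close>

lemma minkowski_ratio_times_powr:
  fixes U :: "'a::euclidean_space set"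
  assumes "0 < r"
  shows "minkowski_ratio s U r * ennreal (r powr (real DIM('a) - s)) =
    emeasure lebesgue (closed_nbhd U r)"
  using assms by (simp add: minkowski_ratio_def ennreal_divide_times)

text \<open>Bounds for the ratios of \<open>U\<close> at all radii up to \<open>\<epsilon>\<close> carry over to \<open>U \<times> {0}\<close> at \<open>\<epsilon>\<close>, because
  the slices have radii at most \<open>\<epsilon>\<close>. The two heights \<open>t = \<plusminus>\<epsilon>\<close>, whose slices have radius \<open>0\<close>,
  form a null set.\<close>

lemma minkowski_ratio_embed_bounds:
  fixes U :: "'a::euclidean_space set"
  assumes s: "s \<le> real DIM('a)" and \<epsilon>: "0 < \<epsilon>"
  defines "K \<equiv> ennreal (unit_ball_vol (real DIM('a) + 1 - s) / unit_ball_vol (real DIM('a) - s))"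
  shows minkowski_ratio_embed_ge:
      "(\<And>r. \<lbrakk>0 < r; r \<le> \<epsilon>\<rbrakk> \<Longrightarrow> c \<le> minkowski_ratio s U r) \<Longrightarrow>
        c * K \<le> minkowski_ratio s (U \<times> {0::real}) \<epsilon>"
    and minkowski_ratio_embed_le:
      "(\<And>r. \<lbrakk>0 < r; r \<le> \<epsilon>\<rbrakk> \<Longrightarrow> minkowski_ratio s U r \<le> c) \<Longrightarrow>
        minkowski_ratio s (U \<times> {0::real}) \<epsilon> \<le> c * K"
proof -
  define a where "a = real DIM('a) - s"
  define E where "E = ennreal (\<epsilon> powr (a + 1))"
  let ?V = "\<lambda>r. emeasure lebesgue (closed_nbhd U r)"
  have a: "0 \<le> a" "real DIM('a) + 1 - s = a + 1" "real DIM('a \<times> real) - s = a + 1"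
    using s by (auto simp: a_def)
  have K: "K = ennreal (unit_ball_vol (a + 1) / unit_ball_vol a)"
    unfolding K_def a(2) by (simp only: a_def)
  have E: "E \<noteq> 0" "E \<noteq> top" using \<epsilon> by (auto simp: E_def)
  have ratio: "minkowski_ratio s (U \<times> {0::real}) \<epsilon> =
      (\<integral>\<^sup>+t. indicator {-\<epsilon>..\<epsilon>} t * ?V (sqrt (\<epsilon>\<^sup>2 - t\<^sup>2)) \<partial>lborel) / E"
    using \<epsilon> emeasure_closed_nbhd_embed[of \<epsilon> U] unfolding minkowski_ratio_def a(3) E_def by simp
  have "(\<integral>\<^sup>+t. c * (indicator {-\<epsilon>..\<epsilon>} t * ennreal (sqrt (\<epsilon>\<^sup>2 - t\<^sup>2) powr a)) \<partial>lborel) = c * (E * K)"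
    using nn_integral_half_disc_powr[OF a(1) \<epsilon>] a
    by (subst nn_integral_cmult) (auto simp: E_def K simp flip: ennreal_mult'')
  hence "(\<integral>\<^sup>+t. c * (indicator {-\<epsilon>..\<epsilon>} t * ennreal (sqrt (\<epsilon>\<^sup>2 - t\<^sup>2) powr a)) \<partial>lborel) / E
      = (c * K) * E / E"
    by (simp only: mult_ac)
  also have "\<dots> = c * K"
    using ennreal_mult_divide_eq[of E "c * K"] E by simp
  finally have cK: "c * K =
    (\<integral>\<^sup>+t. c * (indicator {-\<epsilon>..\<epsilon>} t * ennreal (sqrt (\<epsilon>\<^sup>2 - t\<^sup>2) powr a)) \<partial>lborel) / E" by simp
  have null: "AE t in lborel. t \<notin> {-\<epsilon>, \<epsilon>}"
    by (intro AE_not_in countable_imp_null_set_lborel) auto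
  have radius: "0 < sqrt (\<epsilon>\<^sup>2 - t\<^sup>2) \<and> sqrt (\<epsilon>\<^sup>2 - t\<^sup>2) \<le> \<epsilon>" if "t \<in> {-\<epsilon>..\<epsilon>}" "t \<notin> {-\<epsilon>, \<epsilon>}" for t
  proof -
    have "\<bar>t\<bar> < \<bar>\<epsilon>\<bar>" using that \<epsilon> by auto
    hence "t\<^sup>2 < \<epsilon>\<^sup>2" by (simp add: power2_strict_mono)
    thus ?thesis using \<epsilon> by (auto intro: real_le_lsqrt)
  qed
  note V = minkowski_ratio_times_powr[of _ s U, folded a_def]
  {
    assume *: "\<And>r. \<lbrakk>0 < r; r \<le> \<epsilon>\<rbrakk> \<Longrightarrow> c \<le> minkowski_ratio s U r"
    have "AE t in lborel. c * (indicator {-\<epsilon>..\<epsilon>} t * ennreal (sqrt (\<epsilon>\<^sup>2 - t\<^sup>2) powr a)) \<le>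
        indicator {-\<epsilon>..\<epsilon>} t * ?V (sqrt (\<epsilon>\<^sup>2 - t\<^sup>2))"
      using null
    proof eventually_elim
      case (elim t)
      show ?case
      proof (cases "t \<in> {-\<epsilon>..\<epsilon>}")
        case True
        with radius[of t] elim V[of "sqrt (\<epsilon>\<^sup>2 - t\<^sup>2)", symmetric] *[of "sqrt (\<epsilon>\<^sup>2 - t\<^sup>2)"]
        show ?thesis by (auto intro: mult_right_mono)
      qed auto
    qed
    thus "c * K \<le> minkowski_ratio s (U \<times> {0::real}) \<epsilon>"
      unfolding cK ratio by (intro divide_right_mono_ennreal nn_integral_mono_AE)
  next
    assume *: "\<And>r. \<lbrakk>0 < r; r \<le> \<epsilon>\<rbrakk> \<Longrightarrow> minkowski_ratio s U r \<le> c"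
    have "AE t in lborel. indicator {-\<epsilon>..\<epsilon>} t * ?V (sqrt (\<epsilon>\<^sup>2 - t\<^sup>2)) \<le>
        c * (indicator {-\<epsilon>..\<epsilon>} t * ennreal (sqrt (\<epsilon>\<^sup>2 - t\<^sup>2) powr a))"
      using null
    proof eventually_elim
      case (elim t)
      show ?case
      proof (cases "t \<in> {-\<epsilon>..\<epsilon>}")
        case True
        with radius[of t] elim V[of "sqrt (\<epsilon>\<^sup>2 - t\<^sup>2)", symmetric] *[of "sqrt (\<epsilon>\<^sup>2 - t\<^sup>2)"]
        show ?thesis by (auto intro: mult_right_mono)
      qed auto
    qed
    thus "minkowski_ratio s (U \<times> {0::real}) \<epsilon> \<le> c * K"
      unfolding cK ratio by (intro divide_right_mono_ennreal nn_integral_mono_AE)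
  }
qed

lemma tendsto_minkowski_ratio_embed:
  fixes U :: "'a::euclidean_space set"
  assumes s: "s \<le> real DIM('a)" and M: "(minkowski_ratio s U \<longlongrightarrow> M) (at_right 0)"
  shows "(minkowski_ratio s (U \<times> {0::real}) \<longlongrightarrow>
    M * ennreal (unit_ball_vol (real DIM('a) + 1 - s) / unit_ball_vol (real DIM('a) - s)))
    (at_right 0)"
    (is "(_ \<longlongrightarrow> M * ?K) _")
proof (rule order_tendstoI)
  have "0 < ?K" using s by (simp add: unit_ball_vol_pos divide_pos_pos)
  hence K: "?K \<noteq> 0" "?K < top" "?K \<noteq> top" by auto
  fix x assume "x < M * ?K"
  hence "x / ?K < M" using divide_less_ennreal K by blast
  then obtain c where c: "x / ?K < c" "c < M" using dense by blast
  from c(1) have xc: "x < c * ?K" using divide_less_ennreal K by blast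
  from order_tendstoD(1)[OF M c(2)] obtain b where
    b: "b > 0" "\<And>r. 0 < r \<Longrightarrow> r < b \<Longrightarrow> c < minkowski_ratio s U r"
    by (auto simp: eventually_at_right_field)
  have "x < minkowski_ratio s (U \<times> {0::real}) \<epsilon>" if "0 < \<epsilon>" "\<epsilon> < b" for \<epsilon>
    using that b(2) by (intro less_le_trans[OF xc] minkowski_ratio_embed_ge[OF s])
      (auto intro!: less_imp_le)
  with b(1) show "\<forall>\<^sub>F \<epsilon> in at_right 0. x < minkowski_ratio s (U \<times> {0::real}) \<epsilon>"
    by (auto simp: eventually_at_right_field)
next
  have "0 < ?K" using s by (simp add: unit_ball_vol_pos divide_pos_pos)
  hence K: "?K \<noteq> 0" "?K < top" "?K \<noteq> top" by auto
  fix x assume "M * ?K < x"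
  have cancel: "x / ?K * ?K = x"
    using ennreal_divide_self[OF K(1,2)] by (simp only: ennreal_divide_times mult_1_right)
  have "M < x / ?K"
  proof (rule ccontr)
    assume "\<not> M < x / ?K"
    hence "x / ?K * ?K \<le> M * ?K" by (intro mult_right_mono) auto
    with \<open>M * ?K < x\<close> cancel show False by simp
  qed
  then obtain c where c: "M < c" "c < x / ?K" using dense by blast
  have cx: "c * ?K < x"
  proof (rule ccontr)
    assume "\<not> c * ?K < x"
    hence "x / ?K \<le> c * ?K / ?K" by (intro divide_right_mono_ennreal) auto
    with c(2) ennreal_mult_divide_eq[OF K(1,3), of c] show False by simp
  qed
  from order_tendstoD(2)[OF M c(1)] obtain b where
    b: "b > 0" "\<And>r. 0 < r \<Longrightarrow> r < b \<Longrightarrow> minkowski_ratio s U r < c"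
    by (auto simp: eventually_at_right_field)
  have "minkowski_ratio s (U \<times> {0::real}) \<epsilon> < x" if "0 < \<epsilon>" "\<epsilon> < b" for \<epsilon>
    using that b(2) by (intro le_less_trans[OF _ cx] minkowski_ratio_embed_le[OF s])
      (auto intro!: less_imp_le)
  with b(1) show "\<forall>\<^sub>F \<epsilon> in at_right 0. minkowski_ratio s (U \<times> {0::real}) \<epsilon> < x"
    by (auto simp: eventually_at_right_field)
qed

section \<open>Recovering the box dimension from the content\<close>

lemma minkowski_contents_eq_iff_tendsto:
  "lower_minkowski_content s U = M \<and> upper_minkowski_content s U = M \<longleftrightarrow>
    (minkowski_ratio s U \<longlongrightarrow> M) (at_right 0)"
  unfolding lower_minkowski_content_def upper_minkowski_content_def
  by (simp add: tendsto_iff_Liminf_eq_Limsup)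

lemma minkowski_ratio_change_exponent:
  fixes U :: "'a::euclidean_space set"
  assumes "0 < \<epsilon>"
  shows "minkowski_ratio s U \<epsilon> = minkowski_ratio d U \<epsilon> * ennreal (\<epsilon> powr (s - d))"
proof -
  let ?E = "ennreal (\<epsilon> powr (real DIM('a) - s))"
  have "ennreal (\<epsilon> powr (real DIM('a) - d)) = ennreal (\<epsilon> powr (s - d)) * ?E"
    by (simp flip: powr_add ennreal_mult)
  hence "minkowski_ratio s U \<epsilon> = minkowski_ratio d U \<epsilon> * ennreal (\<epsilon> powr (s - d)) * ?E / ?E"
    using minkowski_ratio_times_powr[OF assms, of d U]
    by (simp add: minkowski_ratio_def[of s] mult.assoc)
  thus ?thesis
    using assms ennreal_mult_divide_eq[of ?E] by simp
qed

text \<open>The ratios at exponent \<open>s\<close> are those at exponent \<open>d\<close> multiplied by \<open>\<epsilon> powr (s - d)\<close>, which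
  tends to \<open>\<infinity>\<close> or \<open>0\<close>; so the jump of the contents from \<open>\<infinity>\<close> to \<open>0\<close> takes place at \<open>d\<close>.\<close>

lemma has_box_dim_if_tendsto:
  fixes U :: "'a::euclidean_space set"
  assumes d: "0 \<le> d" and M: "(minkowski_ratio d U \<longlongrightarrow> M) (at_right 0)" "0 < M" "M < \<infinity>"
  shows "has_box_dim U d"
proof -
  have lim: "(minkowski_ratio s U \<longlongrightarrow> M * L) (at_right 0)"
    if "((\<lambda>\<epsilon>. ennreal (\<epsilon> powr (s - d))) \<longlongrightarrow> L) (at_right 0)" for s L
  proof -
    have "((\<lambda>\<epsilon>. minkowski_ratio d U \<epsilon> * ennreal (\<epsilon> powr (s - d))) \<longlongrightarrow> M * L) (at_right 0)"
      using M that by (intro tendsto_mult_ennreal) auto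
    moreover have "\<forall>\<^sub>F \<epsilon> in at_right 0.
        minkowski_ratio d U \<epsilon> * ennreal (\<epsilon> powr (s - d)) = minkowski_ratio s U \<epsilon>"
      using eventually_at_right_less
      by eventually_elim (simp add: minkowski_ratio_change_exponent[of _ s U d])
    ultimately show ?thesis by (rule Lim_transform_eventually)
  qed
  have below: "lower_minkowski_content s U = \<infinity> \<and> upper_minkowski_content s U = \<infinity>" if "s < d" for s
  proof -
    have "filterlim (\<lambda>\<epsilon>::real. \<epsilon> powr (s - d)) at_top (at_right 0)"
      using that by real_asymp
    hence "((\<lambda>\<epsilon>. ennreal (\<epsilon> powr (s - d))) \<longlongrightarrow> top) (at_right 0)"
      by (simp add: ennreal_tendsto_top_eq_at_top)
    from lim[OF this] show ?thesis
      using M by (simp add: minkowski_contents_eq_iff_tendsto ennreal_mult_top split: if_splits)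
  qed
  have above: "lower_minkowski_content s U \<noteq> \<infinity> \<and> upper_minkowski_content s U \<noteq> \<infinity>" if "d \<le> s" for s
  proof (cases "s = d")
    case True
    thus ?thesis using M minkowski_contents_eq_iff_tendsto[of d U M] by auto
  next
    case False
    hence "((\<lambda>\<epsilon>::real. \<epsilon> powr (s - d)) \<longlongrightarrow> 0) (at_right 0)"
      using that by real_asymp
    hence "((\<lambda>\<epsilon>. ennreal (\<epsilon> powr (s - d))) \<longlongrightarrow> 0) (at_right 0)"
      using tendsto_ennrealI by fastforce
    from lim[OF this] show ?thesis
      using minkowski_contents_eq_iff_tendsto[of s U 0] by auto
  qed
  have "{s. 0 \<le> s \<and> lower_minkowski_content s U = \<infinity>} = {0..<d}"
    "{s. 0 \<le> s \<and> upper_minkowski_content s U = \<infinity>} = {0..<d}"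
    using below above by (force simp: not_le[symmetric])+
  moreover have "Sup (insert 0 {0..<d}) = d"
    using d by (cases "d = 0") (auto simp: insert_absorb)
  ultimately show ?thesis by (simp add: has_box_dim_def lower_box_dim_def upper_box_dim_def)
qed

section \<open>Invariance of the normalized Minkowski content\<close>

lemma box_dim_eq: "has_box_dim U d \<Longrightarrow> box_dim U = d"
  by (auto simp: box_dim_def has_box_dim_def)

lemma minkowski_measurable_iff_tendsto:
  assumes "has_box_dim U d"
  shows "minkowski_measurable U \<longleftrightarrow>
    bounded U \<and> (\<exists>M. (minkowski_ratio d U \<longlongrightarrow> M) (at_right 0) \<and> 0 < M \<and> M < \<infinity>)"
proof -
  have "has_box_dim U d' \<longleftrightarrow> d' = d" for d'
    using assms by (auto simp: has_box_dim_def)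
  thus ?thesis
    unfolding minkowski_measurable_def minkowski_contents_eq_iff_tendsto[symmetric] by auto
qed

theorem theorem4:
  fixes U :: "(real ^ 'n) set" and d :: real
  assumes "minkowski_measurable U"
    and "has_box_dim U d"
    and "d \<in> {0..real CARD('n)}"
  shows "minkowski_measurable (U \<times> {0::real}) \<and>
    minkowski_content (U \<times> {0::real}) / ennreal (unit_ball_vol (real CARD('n) + 1 - d)) =
      minkowski_content U / ennreal (unit_ball_vol (real CARD('n) - d)) \<and>
    normalized_minkowski_content (U \<times> {0::real}) = normalized_minkowski_content U"
proof -
  define A where "A = unit_ball_vol (real CARD('n) - d)"
  define B where "B = unit_ball_vol (real CARD('n) + 1 - d)"
  have AB: "0 < A" "0 < B" using assms(3) by (auto simp: A_def B_def)
  obtain M where M: "(minkowski_ratio d U \<longlongrightarrow> M) (at_right 0)" "0 < M" "M < \<infinity>" and bdd: "bounded U"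
    using assms(1) minkowski_measurable_iff_tendsto[OF assms(2)] by auto
  define M' where "M' = M * ennreal (B / A)"
  have M': "(minkowski_ratio d (U \<times> {0::real}) \<longlongrightarrow> M') (at_right 0)"
    using tendsto_minkowski_ratio_embed[OF _ M(1)] assms(3) by (simp add: M'_def A_def B_def)
  have M'_pos: "0 < M'" "M' < \<infinity>"
    using M AB by (auto simp: M'_def ennreal_zero_less_mult_iff ennreal_mult_less_top)
  have dim': "has_box_dim (U \<times> {0::real}) d"
    using has_box_dim_if_tendsto[OF _ M' M'_pos] assms(3) by simp
  have measurable: "minkowski_measurable (U \<times> {0::real})"
    using minkowski_measurable_iff_tendsto[OF dim'] M' M'_pos bdd by (auto intro: bounded_Times)
  have content: "minkowski_content U = M" "minkowski_content (U \<times> {0::real}) = M'"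
    using minkowski_contents_eq_iff_tendsto M(1) M'
    by (auto simp: minkowski_content_def box_dim_eq[OF assms(2)] box_dim_eq[OF dim'])
  have "M' / ennreal B = M / ennreal A"
  proof (cases M)
    case (real m)
    thus ?thesis using AB by (simp add: M'_def divide_ennreal flip: ennreal_mult)
  qed (use M in auto)
  with measurable show ?thesis
    by (simp add: content normalized_minkowski_content_def box_dim_eq[OF assms(2)]
        box_dim_eq[OF dim'] A_def B_def algebra_simps)
qed

end
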